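(* Let $\alpha$ be a nonzero complex number, $\lambda$ a complex number, and $n,k\ge 0$ integers. Then $$y_{1,\alpha}^{*}(n,k+1;\lambda)=\frac{1}{k+1}\left(\lambda\sum_{\ell=0}^{n}\binom{n}{\ell}y_{1,\alpha}^{*}(\ell,k;\lambda)+(1-k\alpha)\,y_{1,\alpha}^{*}(n,k;\lambda)\right).$$
   Context: For an element $x$ of a commutative $\mathbb{C}$-algebra (e.g. a number or a formal power series in $t$), the degenerate falling factorial is $(x)_{0,\alpha}=1$ and $(x)_{n,\alpha}=x(x-\alpha)(x-2\alpha)\cdots(x-(n-1)\alpha)$ for $n\ge 1$. The new type degenerate Simsek numbers $y_{1,\alpha}^{*}(n,k;\lambda)$ are defined by the generating function $$\frac{(\lambda e^t+1)_{k,\alpha}}{k!}=\sum_{n=0}^{\infty}y_{1,\alpha}^{*}(n,k;\lambda)\frac{t^n}{n!}.$$ *)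

theory Defs
  imports Complex_Main "HOL-Computational_Algebra.Formal_Power_Series"
begin

text \<open>
  The degenerate falling factorial \<open>(x)\<^sub>n\<^sub>,\<^sub>\<alpha> = x (x - \<alpha>) \<dots> (x - (n - 1) \<alpha>)\<close>.  The parameter \<open>a\<close>
  lies in the same ring as \<open>x\<close>; in a \<open>\<complex>\<close>-algebra it is the image of the scalar \<open>\<alpha>\<close>.
\<close>

definition degenerate_ffact :: "'a::comm_ring_1 \<Rightarrow> nat \<Rightarrow> 'a \<Rightarrow> 'a" where
  "degenerate_ffact x n a = (\<Prod>i<n. x - of_nat i * a)"

text \<open>
  Generating function \<open>(\<lambda> e\<^sup>t + 1)\<^sub>k\<^sub>,\<^sub>\<alpha> / k!\<close> as a formal power series in \<open>t\<close>.
\<close>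

definition simsek_gf :: "complex \<Rightarrow> nat \<Rightarrow> complex \<Rightarrow> complex fps" where
  "simsek_gf \<alpha> k l =
     fps_const (1 / fact k) *
     degenerate_ffact (fps_const l * fps_exp 1 + 1) k (fps_const \<alpha>)"

text \<open>
  \<open>simsek \<alpha> n k l\<close> is \<open>y\<^sup>*\<^sub>1\<^sub>,\<^sub>\<alpha>(n, k; l)\<close>: the coefficient of \<open>t\<^sup>n / n!\<close>, as confirmed by
  \<open>simsek_generating_function\<close>.
\<close>

definition simsek :: "complex \<Rightarrow> nat \<Rightarrow> nat \<Rightarrow> complex \<Rightarrow> complex" where
  "simsek \<alpha> n k l = fact n * fps_nth (simsek_gf \<alpha> k l) n"

lemma simsek_generating_function:
  "simsek_gf \<alpha> k l = Abs_fps (\<lambda>n. simsek \<alpha> n k l / fact n)"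
  by (simp add: fps_eq_iff simsek_def)

end

theory Submission
  imports Defs
begin

text \<open>Passing from k to k + 1 appends the factor l e^t + 1 - k \<alpha> to the degenerate
  factorial, so the generating functions F_k satisfy (k + 1) F_(k+1) = l e^t F_k + (1 - k \<alpha>)
  F_k (\<open>simsek_gf_Suc\<close>). Comparing coefficients of t^n / n! gives the recurrence, the
  binomial sum coming from the factor e^t (\<open>fact_mult_nth_mult_fps_exp\<close>).\<close>

lemma simsek_gf_Suc:
  "simsek_gf \<alpha> (Suc k) l =
    fps_const (1 / of_nat (Suc k)) *
      (fps_const l * (simsek_gf \<alpha> k l * fps_exp 1)
       + fps_const (1 - of_nat k * \<alpha>) * simsek_gf \<alpha> k l)"
proof -
  let ?D = "degenerate_ffact (fps_const l * fps_exp 1 + 1) k (fps_const \<alpha>)"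
  have c: "fps_const (1 / fact (Suc k) :: complex)
      = fps_const (1 / of_nat (Suc k)) * fps_const (1 / fact k)"
    by simp
  \<comment> \<open>Splitting this constant series puts it in the shape of the new factor in
    \<open>D\<close>; what remains is a commutative ring identity.\<close>
  have s: "fps_const (1 - of_nat k * \<alpha>) = 1 - of_nat k * fps_const \<alpha>"
    by (simp add: fps_of_nat flip: fps_const_1_eq_1 fps_const_sub fps_const_mult)
  have D: "degenerate_ffact (fps_const l * fps_exp 1 + 1) (Suc k) (fps_const \<alpha>)
      = ?D * (fps_const l * fps_exp 1 + 1 - of_nat k * fps_const \<alpha>)"
    by (simp add: degenerate_ffact_def)
  show ?thesis
    unfolding simsek_gf_def c s D by (simp only: algebra_simps)
qed

text \<open>Multiplication by e^t is the binomial transform of exponential coefficients: e^t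
  contributes 1 / (n - j)! to the Cauchy product, and n! / (n - j)! = (n choose j) j!.\<close>

lemma fact_mult_nth_mult_fps_exp:
  fixes f :: "'a::field_char_0 fps"
  shows "fact n * fps_nth (f * fps_exp 1) n =
    (\<Sum>j=0..n. of_nat (n choose j) * (fact j * fps_nth f j))"
  by (simp add: fps_mult_nth sum_distrib_left binomial_fact field_simps)

theorem theorem2p9:
  fixes \<alpha> l :: complex and n k :: nat
  assumes "\<alpha> \<noteq> 0"
  shows "simsek \<alpha> n (k + 1) l =
    1 / of_nat (k + 1) *
      (l * (\<Sum>j=0..n. of_nat (n choose j) * simsek \<alpha> j k l)
       + (1 - of_nat k * \<alpha>) * simsek \<alpha> n k l)"
proof -
  have "simsek \<alpha> n (k + 1) l = 1 / of_nat (k + 1) *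
      (l * (fact n * fps_nth (simsek_gf \<alpha> k l * fps_exp 1) n)
       + (1 - of_nat k * \<alpha>) * simsek \<alpha> n k l)"
    unfolding simsek_def Suc_eq_plus1[symmetric] simsek_gf_Suc
      fps_mult_left_const_nth fps_add_nth
    by (simp only: algebra_simps)
  then show ?thesis
    by (simp only: fact_mult_nth_mult_fps_exp simsek_def)
qed

end
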